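(* Let $(I,+,\preceq_I,\ast)$ be a partially ordered commutative ring. Let $x_1,x_2,x_3,x_4\in I$ with $x_i\succeq_I x_{i+1}$ for $1\leq i\leq 3$ and $x_1+x_4\succeq_I x_2+x_3$, and let $n\geq 0$ be an integer. Let $a_1,a_2,a_3,a_4\in I$ and suppose that for each $i\in\{2,4\}$ there is an upper bound $\hat a_i\in I$ of $\{a_i,-a_i\}$ such that $a_1\succeq_I\hat a_2\succeq_I a_3\succeq_I\hat a_4\succeq_I 0$. Then $$\sum_{i=1}^4 a_i\ast\prod_{\substack{1\leq j\leq 4\\ j\neq i}}(x_i-x_j)^n\succeq_I 0,$$ where the product is taken with respect to $\ast$.
   Context: A partially ordered Abelian group $(I,+,\preceq_I)$ is an Abelian group with a partial order such that $x+z\preceq_I y+z\Leftrightarrow x\preceq_I y$ for all $x,y,z\in I$. A partially ordered commutative ring $(I,+,\preceq_I,\ast)$ is a partially ordered Abelian group together with an operation $\ast:I\times I\to I$ that is associative, commutative, distributive over $+$, nonnegativity-preserving ($x\succeq_I 0$ and $y\succeq_I 0$ imply $x\ast y\succeq_I 0$), and has an identity element in $I$. Powers $x^n$ are with respect to $\ast$. An element $u$ is an upper bound of $S\subset I$ if $u\succeq_I s$ for all $s\in S$. *)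

theory Defs
  imports Main
begin

(* Unlike comm_ring_1 and the ordered unital semiring classes, this class assumes neither
   0 \<noteq> 1 nor 0 \<le> 1: the identity (from comm_monoid_mult) is an arbitrary element.
   The order is compatible with addition through add_left_mono of ordered_ab_group_add;
   the converse implication follows by cancellation (add_le_cancel_right). *)
class partially_ordered_comm_ring = comm_ring + comm_monoid_mult + ordered_ab_group_add +
  assumes nonneg_mult_nonneg: "0 \<le> x \<Longrightarrow> 0 \<le> y \<Longrightarrow> 0 \<le> x * y"
begin

subclass ordered_comm_ring
proof
  fix a b c :: 'a
  assume "a \<le> b" and "0 \<le> c"
  then have "0 \<le> c * (b - a)"
    by (simp add: nonneg_mult_nonneg)
  then show "c * a \<le> c * b"
    by (simp add: right_diff_distrib)
qed

end

definition is_upper_bound :: "'a::order \<Rightarrow> 'a set \<Rightarrow> bool" where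
  "is_upper_bound u S \<longleftrightarrow> (\<forall>s\<in>S. s \<le> u)"

end

theory Submission
  imports Defs
begin

text \<open>
  Write \<open>X, Y, Z, W \<ge> 0\<close> for the absolute values of the products belonging to
  \<open>i = 1, 2, 3, 4\<close> at exponent \<open>1\<close>. For \<open>n > 0\<close>, replacing \<open>a\<^sub>2, a\<^sub>4\<close> by their upper bounds
  and summing by parts reduces the claim to \<open>X\<^sup>n \<ge> Y\<^sup>n\<close> and
  \<open>X\<^sup>n - W\<^sup>n \<ge> Y\<^sup>n - Z\<^sup>n\<close>. The latter follows from the case \<open>n = 1\<close> by induction,
  using \<open>X \<ge> Y\<close>, \<open>W \<ge> Z\<close> and \<open>Y \<ge> Z\<close>. With \<open>d = (x\<^sub>1 - x\<^sub>2) - (x\<^sub>3 - x\<^sub>4) \<ge> 0\<close>, the case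
  \<open>n = 1\<close> compares \<open>X - W = (x\<^sub>1 - x\<^sub>4)\<^sup>2 d\<close> with \<open>Y - Z = (x\<^sub>2 - x\<^sub>3)\<^sup>2 d\<close>.
  The exponent \<open>0\<close> is separate because \<open>0 \<le> 1\<close> may fail.
\<close>

lemma power_Suc_nonneg:
  fixes u :: "'a::partially_ordered_comm_ring"
  assumes "0 \<le> u"
  shows "0 \<le> u ^ Suc m"
  using assms by (induction m) (simp_all add: nonneg_mult_nonneg)

lemma power_Suc_mono:
  fixes u v :: "'a::partially_ordered_comm_ring"
  assumes "0 \<le> v" "v \<le> u"
  shows "v ^ Suc m \<le> u ^ Suc m"
proof (induction m)
  case 0
  show ?case using assms by simp
next
  case (Suc m)
  have "v * v ^ Suc m \<le> u * u ^ Suc m"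
    using assms Suc by (intro mult_mono power_Suc_nonneg) auto
  then show ?case by simp
qed

lemma power_Suc_diff_mono:
  fixes X Y Z W :: "'a::partially_ordered_comm_ring"
  assumes "0 \<le> Z" "Z \<le> Y" "Y \<le> X" "Z \<le> W" "Y - Z \<le> X - W"
  shows "Y ^ Suc m - Z ^ Suc m \<le> X ^ Suc m - W ^ Suc m"
proof (induction m)
  case 0
  show ?case using assms by simp
next
  case (Suc m)
  have nonneg: "0 \<le> Y" "0 \<le> X" "0 \<le> W" "0 \<le> Y - Z"
    using assms by (auto intro: order_trans)
  have "0 \<le> Y ^ Suc m - Z ^ Suc m"
    using power_Suc_mono[OF assms(1,2), of m] by (simp only: diff_ge_0_iff_ge)
  then have 1: "Y * (Y ^ Suc m - Z ^ Suc m) \<le> X * (X ^ Suc m - W ^ Suc m)"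
    using assms nonneg Suc by (intro mult_mono)
  have 2: "Z ^ Suc m * (Y - Z) \<le> W ^ Suc m * (X - W)"
    using assms nonneg by (intro mult_mono power_Suc_mono power_Suc_nonneg)
  \<comment> \<open>Both summands compare factor by factor between \<open>(Y, Z)\<close> and
    \<open>(X, W)\<close>: the facts \<open>1\<close> and \<open>2\<close>.\<close>
  have split: "u ^ Suc (Suc m) - v ^ Suc (Suc m) = u * (u ^ Suc m - v ^ Suc m) + v ^ Suc m * (u - v)"
    for u v :: 'a
    by (simp add: algebra_simps)
  show ?case
    unfolding split by (rule add_mono[OF 1 2])
qed

lemma power_minus_cases:
  fixes u :: "'a::partially_ordered_comm_ring"
  shows "(- u) ^ n = u ^ n \<or> (- u) ^ n = - (u ^ n)"
  by (induction n) auto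

text \<open>No parity split is needed: whichever sign \<open>(- u) ^ n\<close> takes,
  \<open>b'\<close> dominates both \<open>b\<close> and \<open>- b\<close>.\<close>

lemma mult_power_minus_ge:
  fixes b b' u :: "'a::partially_ordered_comm_ring"
  assumes "is_upper_bound b' {b, - b}" "0 \<le> u ^ n"
  shows "- (b' * u ^ n) \<le> b * (- u) ^ n"
proof -
  have ub: "b \<le> b'" "- b \<le> b'"
    using assms(1) by (auto simp: is_upper_bound_def)
  have "b * u ^ n \<le> b' * u ^ n" "- b * u ^ n \<le> b' * u ^ n"
    using ub assms(2) by (auto intro!: mult_right_mono simp del: mult_minus_left)
  then show ?thesis
    using power_minus_cases[of u n] by (auto simp: minus_le_iff)
qed

lemma weighted_sum_nonneg:
  fixes b c e f P Q R S :: "'a::partially_ordered_comm_ring"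
  assumes "c \<le> b" "e \<le> c" "f \<le> e" "0 \<le> f"
    and "0 \<le> P" "0 \<le> R" "Q \<le> P" "Q - R \<le> P - S"
  shows "0 \<le> b * P - c * Q + e * R - f * S"
proof -
  \<comment> \<open>The share \<open>f\<close> common to all coefficients weights
    \<open>P - Q + R - S\<close>; beyond it, \<open>b\<close> and \<open>c\<close> share
    \<open>c - f\<close>, which weights \<open>P - Q\<close>. The rests \<open>b - c\<close> and
    \<open>e - f\<close> fall on \<open>P\<close> and \<open>R\<close>.\<close>
  have "0 \<le> (b - c) * P" "0 \<le> (c - f) * (P - Q)" "0 \<le> (e - f) * R"
      "0 \<le> f * ((P - S) - (Q - R))"
    using assms by (auto intro!: nonneg_mult_nonneg intro: order_trans simp only: diff_ge_0_iff_ge)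
  then have "0 \<le> (b - c) * P + (c - f) * (P - Q) + (e - f) * R + f * ((P - S) - (Q - R))"
    by (intro add_nonneg_nonneg)
  also have "\<dots> = b * P - c * Q + e * R - f * S"
    by (simp add: algebra_simps)
  finally show ?thesis .
qed

lemma four_products_compare:
  fixes p q r :: "'a::partially_ordered_comm_ring"
  assumes "0 \<le> q" "0 \<le> r" "r \<le> p"
  defines "X \<equiv> p * ((p + q) * (p + q + r))" and "Y \<equiv> p * (q * (q + r))"
    and "Z \<equiv> (p + q) * (q * r)" and "W \<equiv> (p + q + r) * ((q + r) * r)"
  shows "0 \<le> Z" "Z \<le> Y" "Y \<le> X" "Z \<le> W" "Y - Z \<le> X - W"
proof -
  \<comment> \<open>After substituting \<open>r + d\<close> for \<open>p\<close>, the differences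
    become polynomials in \<open>q\<close>, \<open>r\<close>, \<open>d\<close> with nonnegative
    coefficients.\<close>
  define d where "d = p - r"
  have p: "p = r + d" and d: "0 \<le> d"
    using assms by (auto simp: d_def)
  note nonneg = nonneg_mult_nonneg add_nonneg_nonneg assms(1,2) d
  show "0 \<le> Z"
    unfolding Z_def p by (intro nonneg)
  have "Y - Z = q * q * d"
    unfolding Y_def Z_def p by (simp add: algebra_simps)
  moreover have "0 \<le> q * q * d" by (intro nonneg)
  ultimately show "Z \<le> Y" by (metis diff_ge_0_iff_ge)
  have "X - Y = p * (p * (p + q + r) + q * p)"
    unfolding X_def Y_def by (simp add: algebra_simps)
  moreover have "0 \<le> p * (p * (p + q + r) + q * p)"
    unfolding p by (intro nonneg)
  ultimately show "Y \<le> X" by (metis diff_ge_0_iff_ge)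
  have "W - Z = r * (r * (p + q + r) + q * r)"
    unfolding W_def Z_def by (simp add: algebra_simps)
  moreover have "0 \<le> r * (r * (p + q + r) + q * r)"
    unfolding p by (intro nonneg)
  ultimately show "Z \<le> W" by (metis diff_ge_0_iff_ge)
  \<comment> \<open>The first factor is \<open>(p + q + r)\<^sup>2 - q\<^sup>2\<close>, expanded so
    that no subtraction remains.\<close>
  have "(X - W) - (Y - Z) = ((p + r) * (p + r) + q * (p + r) + q * (p + r)) * d"
    unfolding X_def Y_def Z_def W_def d_def by (simp add: algebra_simps)
  moreover have "0 \<le> ((p + r) * (p + r) + q * (p + r) + q * (p + r)) * d"
    unfolding p by (intro nonneg)
  ultimately show "Y - Z \<le> X - W" by (metis diff_ge_0_iff_ge)
qed

theorem theorem11: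
  fixes x a a_hat :: "nat \<Rightarrow> 'a::partially_ordered_comm_ring"
    and n :: nat
  assumes "\<And>i. 1 \<le> i \<Longrightarrow> i \<le> 3 \<Longrightarrow> x i \<ge> x (i + 1)"
    and "x 1 + x 4 \<ge> x 2 + x 3"
    and "\<And>i. i \<in> {2, 4} \<Longrightarrow> is_upper_bound (a_hat i) {a i, - a i}"
    and "a 1 \<ge> a_hat 2" and "a_hat 2 \<ge> a 3" and "a 3 \<ge> a_hat 4" and "a_hat 4 \<ge> 0"
  shows "(\<Sum>i\<in>{1..4}. a i * (\<Prod>j\<in>{1..4} - {i}. (x i - x j) ^ n)) \<ge> 0"
proof -
  define p q r where "p = x 1 - x 2" and "q = x 2 - x 3" and "r = x 3 - x 4"
  define X Y Z W where "X = p * ((p + q) * (p + q + r))" and "Y = p * (q * (q + r))"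
    and "Z = (p + q) * (q * r)" and "W = (p + q + r) * ((q + r) * r)"
  have q: "0 \<le> q" and r: "0 \<le> r" and rp: "r \<le> p"
    using assms(1)[of 2] assms(1)[of 3] assms(2)
    by (simp_all add: p_def q_def r_def eval_nat_numeral algebra_simps)
  note cmp = four_products_compare[OF q r rp, folded X_def Y_def Z_def W_def]
  have ub: "is_upper_bound (a_hat 2) {a 2, - a 2}" "is_upper_bound (a_hat 4) {a 4, - a 4}"
    using assms(3) by auto
  have I: "{1..4} = {1, 2, 3, 4::nat}" by auto
  \<comment> \<open>Exactly \<open>i - 1\<close> factors have \<open>j < i\<close> and change sign,
    hence the minus for even \<open>i\<close>.\<close>
  have prods: "(x 1 - x 2) * ((x 1 - x 3) * (x 1 - x 4)) = X"
    "(x 2 - x 1) * ((x 2 - x 3) * (x 2 - x 4)) = - Y"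
    "(x 3 - x 1) * ((x 3 - x 2) * (x 3 - x 4)) = Z"
    "(x 4 - x 1) * ((x 4 - x 2) * (x 4 - x 3)) = - W"
    by (simp_all add: X_def Y_def Z_def W_def p_def q_def r_def algebra_simps)
  have sum_eq: "(\<Sum>i\<in>{1..4}. a i * (\<Prod>j\<in>{1..4} - {i}. (x i - x j) ^ n))
      = a 1 * X ^ n + a 2 * (- Y) ^ n + a 3 * Z ^ n + a 4 * (- W) ^ n"
    unfolding I by (simp add: insert_Diff_if add.assoc flip: prods power_mult_distrib)
  show ?thesis
  proof (cases n)
    case 0
    \<comment> \<open>All products are \<open>1\<close> here, so the sum is that of the
      \<open>a i\<close>; the upper bounds make each adjacent pair nonnegative.\<close>
    have "- a 2 \<le> a 1" "- a 4 \<le> a 3"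
      using ub assms(4,6) by (auto simp: is_upper_bound_def intro: order_trans)
    then have "0 \<le> a 1 + a 2" "0 \<le> a 3 + a 4"
      using diff_ge_0_iff_ge[of "a 1" "- a 2"] diff_ge_0_iff_ge[of "a 3" "- a 4"] by simp_all
    then have "0 \<le> (a 1 + a 2) + (a 3 + a 4)" by (rule add_nonneg_nonneg)
    then show ?thesis unfolding sum_eq by (simp add: 0 add.assoc)
  next
    case (Suc m)
    have nonneg: "0 \<le> Y" "0 \<le> X" "0 \<le> W"
      using cmp by (auto intro: order_trans)
    note pow = nonneg[THEN power_Suc_nonneg, of m, folded Suc]
    have "0 \<le> a 1 * X ^ n - a_hat 2 * Y ^ n + a 3 * Z ^ n - a_hat 4 * W ^ n"
      using assms pow power_Suc_nonneg[OF cmp(1), of m, folded Suc]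
        power_Suc_mono[OF nonneg(1) cmp(3), of m, folded Suc]
        power_Suc_diff_mono[OF cmp, of m, folded Suc]
      by (intro weighted_sum_nonneg) auto
    also have "\<dots> = a 1 * X ^ n + - (a_hat 2 * Y ^ n) + a 3 * Z ^ n + - (a_hat 4 * W ^ n)"
      by simp
    also have "\<dots> \<le> a 1 * X ^ n + a 2 * (- Y) ^ n + a 3 * Z ^ n + a 4 * (- W) ^ n"
      using ub pow by (intro add_mono order_refl mult_power_minus_ge)
    finally show ?thesis unfolding sum_eq .
  qed
qed

end
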